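(* Let $\mathcal M=\{1,\dots,M\}$, $\mathcal N=\{1,\dots,N\}$, let $\{\mathbf v_n\}_{n\in\mathcal N}$, $\mathbf v_n=(v_{1n},\dots,v_{Mn})\in\mathbb R^M$, be the true value vectors of the D2D pairs, and let $\epsilon>0$. Fix $n\in\mathcal N$ and any vector $\mathbf v'_n\in\mathbb R^M$. Let $\Phi=(\mu,\mathbf p)$ be the output of the Distributed Matching Algorithm (DMA) described in the context run with $\{\mathbf v_k\}_{k\in\mathcal N}$, and $\Phi'=(\mu',\mathbf p')$ its output when D2D pair $n$ uses $\mathbf v'_n$ instead of $\mathbf v_n$ (all other vectors unchanged). Then the true utility of pair $n$ satisfies $$v_{\mu'(n)n}-p'_{\mu'(n)}\le v_{\mu(n)n}-p_{\mu(n)}+(8\min\{M,N\}+1)\epsilon,$$ i.e., a D2D pair can improve its utility by at most $(8\min\{M,N\}+1)\epsilon$ by unilaterally deviating from its true value vector.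
   Context: Conventions: $p_0=0$, $v_{0n}=0$ ($\mu(n)=0$ means unmatched). A matching is $(\mu,\mathbf p)$ with $\mu$ a one-to-one mapping between CUs $\mathcal M$ and D2D pairs $\mathcal N$ (some possibly unmatched) and prices $p_m\ge0$, $p_m=0$ for unmatched CUs; the utility of D2D pair $n$ is $v_{\mu(n)n}-p_{\mu(n)}$. DMA (run with values $v_{mn}$): demand function $D_n(\boldsymbol\beta)=\arg\max_{m}(v_{mn}-\beta_m)$ if $\max_m(v_{mn}-\beta_m)\ge0$, else $0$ (no ties assumed). Initialize $t=1$, $p_m=\beta^1_m=0$, all CUs unmatched. Iteration $t$: (i) each unmatched D2D pair $n$ computes $m=D_n(\boldsymbol\beta^t)$; if $m\ne0$ it proposes to CU $m$ ($g^t_{mn}=1$), else it makes no proposal and stays unmatched. (ii) For each CU $m$: if $\sum_ng^t_{mn}=0$, $\sum_ng^{t-1}_{mn}>0$ and $m$ is unmatched, match $m$ to a random $n^*$ with $g^{t-1}_{mn^*}=1$, set $p_m=\beta^{t-1}_m$, $\beta^{t+1}_m=\beta^t_m$, and set $g^t_{m^*n^*}=0$ for $m^*=D_{n^*}(\boldsymbol\beta^t)$. (iii) For each CU $m$: if $\sum_ng^t_{mn}=1$ and ($m$ was unmatched at $t-1$ or $p_m<\beta^t_m$), match $m$ to the proposer, set $p_m=\beta^t_m$, $\beta^{t+1}_m=\beta^t_m$; else if $\sum_ng^t_{mn}\ge1$, make $m$ unmatched, and if its previous partner $n\ne0$ had $p_m=\beta^t_m$ set $g^t_{mn}=1$, and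 set $\beta^{t+1}_m=\beta^t_m+\epsilon$; otherwise $\beta^{t+1}_m=\beta^t_m$. (iv) $t\leftarrow t+1$; stop when an iteration has no proposal; output $(\mu,\mathbf p)$. *)

theory Defs
  imports Main "HOL.Real"
begin

text \<open>
  Distributed Matching Algorithm (DMA).
  CUs are indexed by 1..M, D2D pairs by 1..N, index 0 means "unmatched".
  Values: v m n is the value of CU m for D2D pair n.
\<close>

record dma_state =
  mu  :: "nat \<Rightarrow> nat"            \<comment> \<open>D2D pair n \<mapsto> CU (0 = unmatched)\<close>
  pr  :: "nat \<Rightarrow> real"
  bt  :: "nat \<Rightarrow> real"
  btp :: "nat \<Rightarrow> real"
  gp  :: "nat \<Rightarrow> nat \<Rightarrow> bool"   \<comment> \<open>g^(t-1)_(m n) (after the modifications of iteration t-1)\<close>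

definition dma_init :: dma_state where
  "dma_init = \<lparr>mu = (\<lambda>_. 0), pr = (\<lambda>_. 0), bt = (\<lambda>_. 0), btp = (\<lambda>_. 0),
               gp = (\<lambda>_ _. False)\<rparr>"

definition demand :: "(nat \<Rightarrow> nat \<Rightarrow> real) \<Rightarrow> nat \<Rightarrow> (nat \<Rightarrow> real) \<Rightarrow> nat \<Rightarrow> nat" where
  "demand v M \<beta> n =
     (if \<exists>m\<in>{1..M}. 0 \<le> v m n - \<beta> m
      then (THE m. m \<in> {1..M} \<and> (\<forall>m'\<in>{1..M}. v m' n - \<beta> m' \<le> v m n - \<beta> m))
      else 0)"

definition no_ties :: "(nat \<Rightarrow> nat \<Rightarrow> real) \<Rightarrow> nat \<Rightarrow> nat \<Rightarrow> (nat \<Rightarrow> real) \<Rightarrow> bool" where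
  "no_ties v M N \<beta> =
     (\<forall>n\<in>{1..N}. (\<exists>m\<in>{1..M}. 0 \<le> v m n - \<beta> m) \<longrightarrow>
        (\<exists>!m. m \<in> {1..M} \<and> (\<forall>m'\<in>{1..M}. v m' n - \<beta> m' \<le> v m n - \<beta> m)))"

definition cu_matched :: "nat \<Rightarrow> (nat \<Rightarrow> nat) \<Rightarrow> nat \<Rightarrow> bool" where
  "cu_matched N f m = (\<exists>n\<in>{1..N}. f n = m)"

definition partner :: "nat \<Rightarrow> (nat \<Rightarrow> nat) \<Rightarrow> nat \<Rightarrow> nat" where
  "partner N f m = (if cu_matched N f m then (THE n. n \<in> {1..N} \<and> f n = m) else 0)"

type_synonym work = "(nat \<Rightarrow> nat) \<times> (nat \<Rightarrow> real) \<times> (nat \<Rightarrow> nat \<Rightarrow> bool) \<times> (nat \<Rightarrow> real)"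
  \<comment> \<open>working data during an iteration: mu, p, g^t, beta^(t+1)\<close>

text \<open>Step (ii) for CU m; c m is the random choice n*.\<close>
definition step_ii ::
  "(nat \<Rightarrow> nat \<Rightarrow> real) \<Rightarrow> nat \<Rightarrow> nat \<Rightarrow> (nat \<Rightarrow> nat) \<Rightarrow> dma_state \<Rightarrow> nat \<Rightarrow> work \<Rightarrow> work" where
  "step_ii v M N c s m w =
     (case w of (f, p, g, bn) \<Rightarrow>
       if (\<forall>n\<in>{1..N}. \<not> g m n) \<and> (\<exists>n\<in>{1..N}. gp s m n) \<and> \<not> cu_matched N f m then
         (let n' = c m; m' = demand v M (bt s) n' in
           (f(n' := m), p(m := btp s m), g(m' := (g m')(n' := False)), bn(m := bt s m)))
       else w)"

definition step_iii :: "real \<Rightarrow> nat \<Rightarrow> dma_state \<Rightarrow> nat \<Rightarrow> work \<Rightarrow> work" where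
  "step_iii eps N s m w =
     (case w of (f, p, g, bn) \<Rightarrow>
       let S = {n\<in>{1..N}. g m n}; old = partner N f m in
       if card S = 1 \<and> (\<not> cu_matched N (mu s) m \<or> p m < bt s m) then
         (let n' = (THE n. n \<in> S) in
           ((f(old := 0))(n' := m), p(m := bt s m), g, bn(m := bt s m)))
       else if card S \<ge> 1 then
         (f(old := 0), p(m := 0),
          (if old \<noteq> 0 \<and> p m = bt s m then g(m := (g m)(old := True)) else g),
          bn(m := bt s m + eps))
       else w)"

definition proposals :: "(nat \<Rightarrow> nat \<Rightarrow> real) \<Rightarrow> nat \<Rightarrow> nat \<Rightarrow> dma_state \<Rightarrow> nat \<Rightarrow> nat \<Rightarrow> bool" where
  "proposals v M N s m n =
     (n \<in> {1..N} \<and> mu s n = 0 \<and> m \<noteq> 0 \<and> demand v M (bt s) n = m)"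

definition has_proposal :: "(nat \<Rightarrow> nat \<Rightarrow> real) \<Rightarrow> nat \<Rightarrow> nat \<Rightarrow> dma_state \<Rightarrow> bool" where
  "has_proposal v M N s = (\<exists>m\<in>{1..M}. \<exists>n\<in>{1..N}. proposals v M N s m n)"

definition iterate ::
  "(nat \<Rightarrow> nat \<Rightarrow> real) \<Rightarrow> real \<Rightarrow> nat \<Rightarrow> nat \<Rightarrow> (nat \<Rightarrow> nat) \<Rightarrow> dma_state \<Rightarrow> dma_state" where
  "iterate v eps M N c s =
     (let w0 = (mu s, pr s, proposals v M N s, bt s);
          w1 = foldl (\<lambda>w m. step_ii v M N c s m w) w0 [1..<M+1];
          w2 = foldl (\<lambda>w m. step_iii eps N s m w) w1 [1..<M+1]
      in (case w2 of (f, p, g, bn) \<Rightarrow>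
            \<lparr>mu = f, pr = p, bt = bn, btp = bt s, gp = g\<rparr>))"

text \<open>Nondeterministic step: any admissible random choice; no ties assumed.\<close>
definition dma_step ::
  "(nat \<Rightarrow> nat \<Rightarrow> real) \<Rightarrow> real \<Rightarrow> nat \<Rightarrow> nat \<Rightarrow> dma_state \<Rightarrow> dma_state \<Rightarrow> bool" where
  "dma_step v eps M N s s' =
     (no_ties v M N (bt s) \<and>
      (\<exists>c. (\<forall>m\<in>{1..M}. (\<exists>n\<in>{1..N}. gp s m n) \<longrightarrow> c m \<in> {1..N} \<and> gp s m (c m)) \<and>
           s' = iterate v eps M N c s))"

inductive dma_reach :: "(nat \<Rightarrow> nat \<Rightarrow> real) \<Rightarrow> real \<Rightarrow> nat \<Rightarrow> nat \<Rightarrow> dma_state \<Rightarrow> bool"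
  for v eps M N where
  init: "dma_reach v eps M N dma_init"
| step: "dma_reach v eps M N s \<Longrightarrow> has_proposal v M N s \<Longrightarrow> dma_step v eps M N s s'
         \<Longrightarrow> dma_reach v eps M N s'"

text \<open>s' is a possible output: the state after the first iteration with no proposal.\<close>
definition dma_output :: "(nat \<Rightarrow> nat \<Rightarrow> real) \<Rightarrow> real \<Rightarrow> nat \<Rightarrow> nat \<Rightarrow> dma_state \<Rightarrow> bool" where
  "dma_output v eps M N s' =
     (\<exists>s. dma_reach v eps M N s \<and> \<not> has_proposal v M N s \<and> dma_step v eps M N s s')"

definition out_price :: "nat \<Rightarrow> dma_state \<Rightarrow> nat \<Rightarrow> real" where
  "out_price N s m = (if m \<noteq> 0 \<and> cu_matched N (mu s) m then pr s m else 0)"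

text \<open>Utility v_{mu(n) n} - p_{mu(n)} with v_{0n} = 0, p_0 = 0.\<close>
definition utility :: "(nat \<Rightarrow> nat \<Rightarrow> real) \<Rightarrow> nat \<Rightarrow> dma_state \<Rightarrow> nat \<Rightarrow> real" where
  "utility v N s n = (if mu s n = 0 then 0 else v (mu s n) n - out_price N s (mu s n))"

definition deviate :: "(nat \<Rightarrow> nat \<Rightarrow> real) \<Rightarrow> nat \<Rightarrow> (nat \<Rightarrow> real) \<Rightarrow> nat \<Rightarrow> nat \<Rightarrow> real" where
  "deviate v n w = (\<lambda>m k. if k = n then w m else v m k)"

end

theory Submission
  imports Defs
begin

text \<open>
  At all times a CU with positive \<open>\<beta>\<close> is either matched, or pending: it was raised in the previous
  iteration by a group of at least two pairs, one of which it takes back if nobody proposes.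
  Looking at the last raise inside a set \<open>T\<close> of CUs with positive \<open>\<beta>\<close> one gets a Hall-type strict
  inequality: more than \<open>|T|\<close> pairs demand, up to \<open>\<epsilon>\<close>, a member of \<open>T\<close>.

  Let \<open>T\<^sub>j\<close> be the CUs whose final \<open>\<beta>\<close> in the truthful run exceeds the one in the deviating run by
  more than \<open>2j\<epsilon>\<close>. All pairs demanding a CU of \<open>T\<^sub>j\<^sub>+\<^sub>1\<close> up to \<open>\<epsilon>\<close> do better in the deviating run and are matched into \<open>T\<^sub>j\<close> there,
  whence \<open>|T\<^sub>j| > |T\<^sub>j\<^sub>+\<^sub>1|\<close>. If the deviation gained more than claimed, the CU obtained by
  pair \<open>n\<close> would lie in \<open>T\<^sub>j\<close> for every \<open>j \<le> 4 min{M,N}\<close>, so that \<open>T\<^sub>0\<close> would be too large.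
\<close>

section \<open>Matching fibres, preferences at given prices, and the demand function\<close>

definition fiber :: "nat \<Rightarrow> (nat \<Rightarrow> nat) \<Rightarrow> nat \<Rightarrow> nat set" where
  "fiber N f m = {k \<in> {1..N}. f k = m}"

definition pending :: "nat \<Rightarrow> dma_state \<Rightarrow> nat \<Rightarrow> bool" where
  "pending N s m \<longleftrightarrow> \<not> cu_matched N (mu s) m \<and> (\<exists>k\<in>{1..N}. gp s m k)"

text \<open>The price \<open>q\<close> asked by \<open>m\<close> is separate from
  \<open>\<beta>\<close> because a pair taken back in step (ii) pays the earlier \<beta>, one
  \<open>eps\<close> below the current one. As \<open>x\<close> ranges over \<open>m\<close> too,
  \<open>q\<close> never exceeds \<open>\<beta> m\<close> for a CU \<open>m\<close>.\<close>

definition best_at :: "(nat \<Rightarrow> nat \<Rightarrow> real) \<Rightarrow> nat \<Rightarrow> (nat \<Rightarrow> real) \<Rightarrow> nat \<Rightarrow> nat \<Rightarrow> real \<Rightarrow> bool" where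
  "best_at v M \<beta> k m q \<longleftrightarrow> q \<le> v m k \<and> (\<forall>x\<in>{1..M}. v x k - \<beta> x \<le> v m k - q)"

text \<open>The slack \<open>eps\<close> is there because a raise lifts \<open>\<beta> m\<close> by
  \<open>eps\<close> above the price at which the group of \<open>m\<close> demanded it.\<close>

definition tight :: "(nat \<Rightarrow> nat \<Rightarrow> real) \<Rightarrow> real \<Rightarrow> nat \<Rightarrow> nat \<Rightarrow> (nat \<Rightarrow> real) \<Rightarrow> nat set \<Rightarrow> nat set" where
  "tight v eps M N \<beta> T = {k \<in> {1..N}. \<exists>m\<in>T. best_at v M \<beta> k m (\<beta> m - eps)}"

lemma best_at_mono:
  assumes "best_at v M \<beta> k m q" "q' \<le> q" "\<And>x. x \<in> {1..M} \<Longrightarrow> \<beta> x \<le> \<beta>' x"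
  shows "best_at v M \<beta>' k m q'"
  using assms unfolding best_at_def by (smt (verit, best))

lemma cu_matched_iff_fiber: "cu_matched N f m \<longleftrightarrow> fiber N f m \<noteq> {}"
  by (auto simp: cu_matched_def fiber_def)

lemma partner_singleton: "fiber N f m = {k} \<Longrightarrow> partner N f m = k"
  unfolding partner_def cu_matched_iff_fiber by (auto simp: fiber_def intro!: the_equality)

lemma partner_empty: "fiber N f m = {} \<Longrightarrow> partner N f m = 0"
  by (simp add: partner_def cu_matched_iff_fiber)

lemma finite_fiber [simp]: "finite (fiber N f m)"
  by (simp add: fiber_def)

text \<open>Absence of ties makes the \<open>THE\<close> in \<open>demand\<close> well defined.
  Strictness of the maximum, the third fact, later excludes that a group member proposes to another
  pending CU.\<close>

lemma demand_nonzero: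
  assumes "no_ties v M N \<beta>" "k \<in> {1..N}" "demand v M \<beta> k = m" "m \<noteq> 0"
  shows "m \<in> {1..M}" "best_at v M \<beta> k m (\<beta> m)"
    "\<And>x. \<lbrakk>x \<in> {1..M}; v m k - \<beta> m \<le> v x k - \<beta> x\<rbrakk> \<Longrightarrow> x = m"
proof -
  let ?A = "\<lambda>m. m \<in> {1..M} \<and> (\<forall>x\<in>{1..M}. v x k - \<beta> x \<le> v m k - \<beta> m)"
  from assms(3,4) have ex: "\<exists>m\<in>{1..M}. 0 \<le> v m k - \<beta> m"
    by (auto simp: demand_def split: if_splits)
  with assms(1,2) have un: "\<exists>!m. ?A m" by (simp add: no_ties_def)
  have "m = (THE m. ?A m)" using assms(3) ex by (simp add: demand_def)
  with theI'[OF un] have A: "?A m" by simp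
  then show "m \<in> {1..M}" by simp
  from ex obtain y where "y \<in> {1..M}" "0 \<le> v y k - \<beta> y" by blast
  with A have "0 \<le> v m k - \<beta> m" by force
  with A show "best_at v M \<beta> k m (\<beta> m)" by (simp add: best_at_def)
  fix x assume x: "x \<in> {1..M}" "v m k - \<beta> m \<le> v x k - \<beta> x"
  with A have "?A x" by force
  with A un show "x = m" by blast
qed

lemma demand_zero:
  assumes "no_ties v M N \<beta>" "k \<in> {1..N}" "demand v M \<beta> k = 0" "x \<in> {1..M}"
  shows "v x k < \<beta> x"
proof (rule ccontr)
  let ?A = "\<lambda>m. m \<in> {1..M} \<and> (\<forall>x\<in>{1..M}. v x k - \<beta> x \<le> v m k - \<beta> m)"
  assume "\<not> v x k < \<beta> x"
  with assms(4) have ex: "\<exists>m\<in>{1..M}. 0 \<le> v m k - \<beta> m" by force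
  with assms(1,2) have un: "\<exists>!m. ?A m" by (simp add: no_ties_def)
  have "demand v M \<beta> k = (THE m. ?A m)" using ex by (simp add: demand_def)
  with theI'[OF un] assms(3) show False by simp
qed

section \<open>The invariant\<close>

text \<open>The band in \<open>matched_price\<close> reflects the two ways of being matched: step
  (iii) accepts at \<beta>, step (ii) takes back at \<beta> - \<epsilon>. For a pending CU,
  \<open>gp\<close> is the group of its last raise and \<open>btp\<close> the price at which that
  group demanded it. The counting of overdemand rests on the dichotomy
  \<open>priced\<close>.\<close>

locale dma_inv =
  fixes v :: "nat \<Rightarrow> nat \<Rightarrow> real" and eps :: real and M N :: nat and s :: dma_state
  assumes eps_pos: "0 < eps"
    and mu_le: "k \<in> {1..N} \<Longrightarrow> mu s k \<le> M"
    and mu_inj: "\<lbrakk>k \<in> {1..N}; l \<in> {1..N}; mu s k = mu s l; mu s k \<noteq> 0\<rbrakk> \<Longrightarrow> k = l"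
    and bt_nonneg: "m \<in> {1..M} \<Longrightarrow> 0 \<le> bt s m"
    and btp_le: "m \<in> {1..M} \<Longrightarrow> btp s m \<le> bt s m"
    and matched_price: "\<lbrakk>k \<in> {1..N}; mu s k = m; m \<noteq> 0\<rbrakk> \<Longrightarrow> bt s m - eps \<le> pr s m \<and> pr s m \<le> bt s m"
    and matched_best: "\<lbrakk>k \<in> {1..N}; mu s k = m; m \<noteq> 0\<rbrakk> \<Longrightarrow> best_at v M (bt s) k m (pr s m)"
    and pending_price: "\<lbrakk>m \<in> {1..M}; pending N s m\<rbrakk> \<Longrightarrow> bt s m = btp s m + eps"
    and pending_best: "\<lbrakk>m \<in> {1..M}; pending N s m; k \<in> {1..N}; gp s m k\<rbrakk>
          \<Longrightarrow> mu s k = 0 \<and> best_at v M (btp s) k m (btp s m)"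
    and pending_two: "\<lbrakk>m \<in> {1..M}; pending N s m\<rbrakk> \<Longrightarrow> 2 \<le> card {k \<in> {1..N}. gp s m k}"
    and pending_disj: "\<lbrakk>m \<in> {1..M}; pending N s m; x \<in> {1..M}; pending N s x; k \<in> {1..N};
          gp s m k; gp s x k\<rbrakk> \<Longrightarrow> m = x"
    and priced: "\<lbrakk>m \<in> {1..M}; 0 < bt s m\<rbrakk> \<Longrightarrow> cu_matched N (mu s) m \<or> pending N s m"
begin

lemma fiber_card: "m \<noteq> 0 \<Longrightarrow> fiber N (mu s) m = {} \<or> (\<exists>k. fiber N (mu s) m = {k})"
proof (cases "fiber N (mu s) m = {}")
  case False
  assume "m \<noteq> 0"
  from False obtain k where k: "k \<in> fiber N (mu s) m" by blast
  have "l = k" if "l \<in> fiber N (mu s) m" for l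
    using mu_inj[of l k] k that \<open>m \<noteq> 0\<close> by (simp add: fiber_def)
  with k show ?thesis by blast
qed simp

text \<open>Give each pending CU of \<open>T\<close> its group and each other CU its partner. These
  sets \<open>H m\<close> are nonempty, pairwise disjoint and made of tight pairs, and the pending
  \<open>y\<close> contributes at least two.\<close>

lemma overdemand_of_pending:
  assumes T: "T \<subseteq> {1..M}" "\<And>m. m \<in> T \<Longrightarrow> 0 < bt s m"
    and y: "y \<in> T" "pending N s y"
  shows "card T < card (tight v eps M N (bt s) T)"
proof -
  define H where "H m = (if pending N s m then {k \<in> {1..N}. gp s m k} else fiber N (mu s) m)" for m
  have fin: "finite T" using T(1) finite_subset by blast
  have finH: "finite (H m)" for m by (simp add: H_def)
  have card1: "1 \<le> card (H m)" if "m \<in> T" for m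
  proof (cases "pending N s m")
    case True
    then show ?thesis using pending_two[of m] that T(1) by (auto simp: H_def)
  next
    case False
    moreover have "cu_matched N (mu s) m \<or> pending N s m"
      by (rule priced) (use that T in auto)
    ultimately have "fiber N (mu s) m \<noteq> {}" by (simp add: cu_matched_iff_fiber)
    then show ?thesis using False by (simp add: H_def Suc_le_eq card_gt_0_iff)
  qed
  have card2: "2 \<le> card (H y)" using y pending_two[of y] T(1) by (auto simp: H_def)
  have disj: "H m \<inter> H x = {}" if "m \<in> T" "x \<in> T" "m \<noteq> x" for m x
  proof (rule ccontr)
    have mx: "m \<in> {1..M}" "x \<in> {1..M}" using that T(1) by auto
    assume "H m \<inter> H x \<noteq> {}"
    then obtain k where k: "k \<in> H m" "k \<in> H x" by blast
    have kN: "k \<in> {1..N}" using k by (auto simp: H_def fiber_def split: if_splits)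
    show False
      using pending_disj[OF mx(1) _ mx(2) _ kN] pending_best[OF mx(1) _ kN]
        pending_best[OF mx(2) _ kN] k that(3) mx
      by (auto simp: H_def fiber_def split: if_splits)
  qed
  have sub: "\<Union> (H ` T) \<subseteq> tight v eps M N (bt s) T"
  proof
    fix k assume "k \<in> \<Union> (H ` T)"
    then obtain m where m: "m \<in> T" "k \<in> H m" by blast
    then have mM: "m \<in> {1..M}" using T(1) by blast
    have kN: "k \<in> {1..N}" using m by (auto simp: H_def fiber_def split: if_splits)
    have "best_at v M (bt s) k m (bt s m - eps)"
    proof (cases "pending N s m")
      case True
      then have "best_at v M (btp s) k m (btp s m)"
        using pending_best[OF mM True kN] m by (simp add: H_def)
      then show ?thesis
        by (rule best_at_mono) (use pending_price[OF mM True] btp_le in auto)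
    next
      case False
      then have "mu s k = m" using m by (simp add: H_def fiber_def)
      then show ?thesis
        using matched_best[OF kN, of m] matched_price[OF kN, of m] mM by (auto intro: best_at_mono)
    qed
    then show "k \<in> tight v eps M N (bt s) T" using m(1) kN by (auto simp: tight_def)
  qed
  have "card T = (\<Sum>m\<in>T. 1)" by simp
  also have "\<dots> < (\<Sum>m\<in>T. card (H m))"
  proof (rule sum_strict_mono_ex1)
    show "\<exists>m\<in>T. 1 < card (H m)" using card2 y(1) by (intro bexI[of _ y]) auto
  qed (use fin card1 in auto)
  also have "\<dots> = card (\<Union> (H ` T))"
    by (rule card_UN_disjoint[symmetric]) (use fin finH disj in auto)
  also have "\<dots> \<le> card (tight v eps M N (bt s) T)"
    by (rule card_mono) (use sub in \<open>auto simp: tight_def\<close>)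
  finally show ?thesis .
qed

end

section \<open>One iteration\<close>

locale dma_iteration = dma_inv +
  fixes c :: "nat \<Rightarrow> nat"
  assumes unique_demand: "no_ties v M N (bt s)"
    and choice: "\<lbrakk>m \<in> {1..M}; \<exists>k\<in>{1..N}. gp s m k\<rbrakk> \<Longrightarrow> c m \<in> {1..N} \<and> gp s m (c m)"
begin

abbreviation "P \<equiv> proposals v M N s"
abbreviation "s' \<equiv> iterate v eps M N c s"

text \<open>\<open>R\<close> collects the CUs that take a group member back in step (ii). It refers
  to the proposals at the start of the iteration although step (ii) withdraws some as it runs;
  \<open>pending_not_abandoned\<close> shows that this makes no difference.\<close>

definition R :: "nat set" where
  "R = {m \<in> {1..M}. pending N s m \<and> (\<forall>k. \<not> P m k)}"

definition S :: "nat \<Rightarrow> nat set" where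
  "S m = {k \<in> {1..N}. P m k \<and> k \<notin> c ` R}"

definition mu_ii :: "nat \<Rightarrow> nat" where
  "mu_ii k = (if k \<in> c ` R then the_inv_into R c k else mu s k)"

definition pr_ii :: "nat \<Rightarrow> real" where
  "pr_ii m = (if m \<in> R then btp s m else pr s m)"

lemma proposal_demand:
  assumes "P m k"
  shows "k \<in> {1..N}" "mu s k = 0" "m \<in> {1..M}" "best_at v M (bt s) k m (bt s m)"
    "\<And>x. \<lbrakk>x \<in> {1..M}; v m k - bt s m \<le> v x k - bt s x\<rbrakk> \<Longrightarrow> x = m"
  using assms demand_nonzero[OF unique_demand, of k m] by (auto simp: proposals_def)

lemma proposal_unique: "\<lbrakk>P m k; P x k\<rbrakk> \<Longrightarrow> m = x"
  by (simp add: proposals_def)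

lemma R_choice:
  assumes "m \<in> R"
  shows "c m \<in> {1..N}" "gp s m (c m)" "mu s (c m) = 0" "best_at v M (btp s) (c m) m (btp s m)"
proof -
  have m: "m \<in> {1..M}" "pending N s m" using assms by (auto simp: R_def)
  then show "c m \<in> {1..N}" "gp s m (c m)" using choice[of m] by (auto simp: pending_def)
  then show "mu s (c m) = 0" "best_at v M (btp s) (c m) m (btp s m)"
    using pending_best[OF m] by auto
qed

lemma inj_c: "inj_on c R"
proof (rule inj_onI)
  fix m x assume mx: "m \<in> R" "x \<in> R" "c m = c x"
  then show "m = x" using pending_disj[of m x "c m"] R_choice[of m] R_choice[of x]
    by (auto simp: R_def)
qed

text \<open>A member of the group of a pending CU never demands another pending CU: the two prices
  were raised by the same amount, so its preference between the two is unchanged. Hence the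
  withdrawals of step (ii) cannot take the last proposal away from a pending CU.\<close>
lemma pending_not_abandoned:
  assumes "m \<in> {1..M}" "pending N s m" "x \<in> R"
  shows "\<not> P m (c x)"
proof
  assume pm: "P m (c x)"
  have x: "x \<in> {1..M}" "pending N s x" using assms(3) by (auto simp: R_def)
  have "v m (c x) - btp s m \<le> v x (c x) - btp s x"
    using R_choice(4)[OF assms(3)] assms(1) by (auto simp: best_at_def)
  then have "v m (c x) - bt s m \<le> v x (c x) - bt s x"
    using pending_price[OF assms(1,2)] pending_price[OF x] by simp
  then have "x = m" using proposal_demand(5)[OF pm] x by blast
  with pm assms(3) show False by (auto simp: R_def)
qed

section \<open>Step (ii) in closed form\<close>

lemma fold_step_ii:
  assumes "j \<le> M"
  shows "\<exists>f. foldl (\<lambda>w m. step_ii v M N c s m w) (mu s, pr s, P, bt s) [1..<j+1]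
      = (f, \<lambda>m. if m \<in> R \<inter> {1..j} then btp s m else pr s m,
         \<lambda>m k. P m k \<and> k \<notin> c ` (R \<inter> {1..j}), bt s)
    \<and> (\<forall>m\<in>R \<inter> {1..j}. f (c m) = m) \<and> (\<forall>k. k \<notin> c ` (R \<inter> {1..j}) \<longrightarrow> f k = mu s k)"
  using assms
proof (induction j)
  case 0
  then show ?case by auto
next
  case (Suc j)
  define m where "m = Suc j"
  define A where "A = R \<inter> {1..j}"
  define A' where "A' = R \<inter> {1..Suc j}"
  have mM: "m \<in> {1..M}" using Suc.prems by (simp add: m_def)
  obtain f where fold: "foldl (\<lambda>w m. step_ii v M N c s m w) (mu s, pr s, P, bt s) [1..<j+1]
      = (f, \<lambda>m. if m \<in> A then btp s m else pr s m, \<lambda>m k. P m k \<and> k \<notin> c ` A, bt s)"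
    and fA: "\<And>x. x \<in> A \<Longrightarrow> f (c x) = x" and fnA: "\<And>k. k \<notin> c ` A \<Longrightarrow> f k = mu s k"
    using Suc by (auto simp: A_def)
  have mA: "m \<notin> A" by (simp add: A_def m_def)
  have upt: "[1..<Suc j + 1] = [1..<j+1] @ [m]" by (simp add: m_def)
  have matched: "cu_matched N f m \<longleftrightarrow> cu_matched N (mu s) m"
  proof -
    have "f k = m \<longleftrightarrow> mu s k = m" for k
    proof (cases "k \<in> c ` A")
      case True
      then obtain x where x: "x \<in> A" "k = c x" by blast
      then have "mu s k = 0" using R_choice(3)[of x] by (auto simp: A_def)
      with x show ?thesis using fA[of x] mA mM by auto
    qed (use fnA in auto)
    then show ?thesis by (simp add: cu_matched_def)
  qed
  show ?case
  proof (cases "m \<in> R")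
    case True
    have A': "A' = insert m A" using True by (auto simp: A'_def A_def m_def)
    have cm: "c m \<notin> c ` A"
      using inj_c True mA by (auto simp: inj_on_def A_def)
    have cond: "(\<forall>n\<in>{1..N}. \<not> (P m n \<and> n \<notin> c ` A)) \<and> (\<exists>n\<in>{1..N}. gp s m n) \<and> \<not> cu_matched N f m"
      using True matched by (auto simp: R_def pending_def)
    let ?d = "demand v M (bt s) (c m)"
    let ?g = "\<lambda>m k. P m k \<and> k \<notin> c ` A"
    \<comment> \<open>Step (ii) deletes \<open>c m\<close> only from the row of the CU that it
      demands. As a pair proposes to no other CU, this amounts to deleting it from all rows.\<close>
    have g: "?g(?d := (?g ?d)(c m := False)) = (\<lambda>m k. P m k \<and> k \<notin> c ` A')"
      by (auto simp: A' fun_eq_iff proposals_def)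
    have p: "(\<lambda>m. if m \<in> A then btp s m else pr s m)(m := btp s m)
        = (\<lambda>m. if m \<in> A' then btp s m else pr s m)"
      by (auto simp: A' fun_eq_iff)
    have "step_ii v M N c s m (f, \<lambda>m. if m \<in> A then btp s m else pr s m, ?g, bt s)
      = (f(c m := m), \<lambda>m. if m \<in> A' then btp s m else pr s m, \<lambda>m k. P m k \<and> k \<notin> c ` A', bt s)"
      unfolding step_ii_def prod.case if_P[OF cond] Let_def g p fun_upd_triv ..
    then have "foldl (\<lambda>w m. step_ii v M N c s m w) (mu s, pr s, P, bt s) [1..<Suc j+1]
      = (f(c m := m), \<lambda>m. if m \<in> A' then btp s m else pr s m, \<lambda>m k. P m k \<and> k \<notin> c ` A', bt s)"
      unfolding upt foldl_append fold foldl.simps .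
    moreover have "\<forall>x\<in>A'. (f(c m := m)) (c x) = x"
      using fA cm unfolding A' by (metis fun_upd_apply image_eqI insert_iff)
    moreover have "\<forall>k. k \<notin> c ` A' \<longrightarrow> (f(c m := m)) k = mu s k" using fnA by (auto simp: A')
    ultimately show ?thesis unfolding A'_def by blast
  next
    case False
    have A': "A' = A"
      using False unfolding A'_def A_def m_def by (auto simp: le_Suc_eq)
    \<comment> \<open>A pending CU outside \<open>R\<close> has a proposal, and
      \<open>pending_not_abandoned\<close> keeps it from being withdrawn, so step (ii) leaves
      \<open>m\<close> alone.\<close>
    have cond: "\<not> ((\<forall>n\<in>{1..N}. \<not> (P m n \<and> n \<notin> c ` A)) \<and> (\<exists>n\<in>{1..N}. gp s m n) \<and> \<not> cu_matched N f m)"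
    proof
      assume a: "(\<forall>n\<in>{1..N}. \<not> (P m n \<and> n \<notin> c ` A)) \<and> (\<exists>n\<in>{1..N}. gp s m n) \<and> \<not> cu_matched N f m"
      then have pend: "pending N s m" using matched by (simp add: pending_def)
      then obtain k where k: "P m k" using False mM by (auto simp: R_def)
      then have "k \<in> c ` A" using a proposal_demand(1)[OF k] by blast
      then show False using pending_not_abandoned[OF mM pend] k by (auto simp: A_def)
    qed
    have "step_ii v M N c s m (f, \<lambda>m. if m \<in> A then btp s m else pr s m, \<lambda>m k. P m k \<and> k \<notin> c ` A, bt s)
      = (f, \<lambda>m. if m \<in> A' then btp s m else pr s m, \<lambda>m k. P m k \<and> k \<notin> c ` A', bt s)"
      unfolding step_ii_def prod.case if_not_P[OF cond] A' ..
    then have "foldl (\<lambda>w m. step_ii v M N c s m w) (mu s, pr s, P, bt s) [1..<Suc j+1]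
      = (f, \<lambda>m. if m \<in> A' then btp s m else pr s m, \<lambda>m k. P m k \<and> k \<notin> c ` A', bt s)"
      unfolding upt foldl_append fold foldl.simps .
    then show ?thesis using fA fnA A' unfolding A'_def by blast
  qed
qed

lemma fold_step_ii_all:
  "foldl (\<lambda>w m. step_ii v M N c s m w) (mu s, pr s, P, bt s) [1..<M+1]
     = (mu_ii, pr_ii, \<lambda>m k. P m k \<and> k \<notin> c ` R, bt s)"
proof -
  have R: "R \<inter> {1..M} = R" by (auto simp: R_def)
  obtain f where f: "foldl (\<lambda>w m. step_ii v M N c s m w) (mu s, pr s, P, bt s) [1..<M+1]
      = (f, \<lambda>m. if m \<in> R then btp s m else pr s m, \<lambda>m k. P m k \<and> k \<notin> c ` R, bt s)"
    "\<forall>m\<in>R. f (c m) = m" "\<forall>k. k \<notin> c ` R \<longrightarrow> f k = mu s k"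
    using fold_step_ii[of M] unfolding R by blast
  have "f k = mu_ii k" for k
    using f(2,3) by (cases "k \<in> c ` R") (auto simp: mu_ii_def the_inv_into_f_f[OF inj_c])
  then have "f = mu_ii" by (rule ext)
  moreover have "(\<lambda>m. if m \<in> R then btp s m else pr s m) = pr_ii" by (auto simp: pr_ii_def)
  ultimately show ?thesis using f(1) by (simp only:)
qed

lemma mu_ii_choice: "m \<in> R \<Longrightarrow> mu_ii (c m) = m"
  by (simp add: mu_ii_def the_inv_into_f_f[OF inj_c])

lemma mu_ii_other: "k \<notin> c ` R \<Longrightarrow> mu_ii k = mu s k"
  by (simp add: mu_ii_def)

lemma fiber_ii:
  assumes "m \<in> {1..M}"
  shows "fiber N mu_ii m = (if m \<in> R then {c m} else fiber N (mu s) m)"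
proof (cases "m \<in> R")
  case True
  then have "\<not> cu_matched N (mu s) m" by (simp add: R_def pending_def)
  then have "k \<in> {c m}" if "k \<in> {1..N}" "mu_ii k = m" for k
    using that mu_ii_other[of k]
    by (cases "k \<in> c ` R") (auto simp: cu_matched_def mu_ii_choice)
  then have "fiber N mu_ii m \<subseteq> {c m}" unfolding fiber_def by blast
  moreover have "c m \<in> fiber N mu_ii m"
    using R_choice(1)[OF True] mu_ii_choice[OF True] by (simp add: fiber_def)
  ultimately show ?thesis using True by auto
next
  case False
  have "mu_ii k = m \<longleftrightarrow> mu s k = m" for k
  proof (cases "k \<in> c ` R")
    case True
    then obtain x where "x \<in> R" "k = c x" by blast
    then show ?thesis using mu_ii_choice[of x] R_choice(3)[of x] False assms by auto
  qed (simp add: mu_ii_other)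
  then show ?thesis using False by (simp add: fiber_def)
qed

lemma fiber_ii_card:
  assumes "m \<in> {1..M}"
  shows "fiber N mu_ii m = {} \<or> (\<exists>k. fiber N mu_ii m = {k})"
  using fiber_ii[OF assms] fiber_card[of m] assms by auto

section \<open>Step (iii): the surviving proposals and the outcome for each CU\<close>

lemma S_proposal: "k \<in> S m \<Longrightarrow> P m k" by (simp add: S_def)

lemma S_unmatched: "k \<in> S m \<Longrightarrow> mu_ii k = 0"
  using mu_ii_other proposal_demand(2) by (auto simp: S_def)

lemma S_not_R: "k \<in> S m \<Longrightarrow> m \<notin> R"
  by (auto simp: S_def R_def)

text \<open>Phrased with the price at the start of the iteration, whereas step (iii) reads the price
  left by step (ii). The two differ only on \<open>R\<close>, and no CU of \<open>R\<close> has a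
  surviving proposal (\<open>S_not_R\<close>).\<close>

definition accepts :: "nat \<Rightarrow> bool" where
  "accepts m \<longleftrightarrow> card (S m) = 1 \<and> (\<not> cu_matched N (mu s) m \<or> pr s m < bt s m)"

text \<open>The three outcomes are acceptance, raise, and no proposal. After a raise the former
  partner enters the group only if it already paid the current \<beta>; one that paid less may not
  want \<open>m\<close> at that price.\<close>

definition resolved :: "nat \<Rightarrow> work \<Rightarrow> bool" where
  "resolved m w = (case w of (f, p, g, b) \<Rightarrow>
     if accepts m then fiber N f m = S m \<and> p m = bt s m \<and> b m = bt s m
     else if S m \<noteq> {} then fiber N f m = {} \<and> b m = bt s m + eps \<and>
       {k \<in> {1..N}. g m k} = S m \<union> {k \<in> fiber N (mu s) m. pr s m = bt s m}
     else fiber N f m = fiber N mu_ii m \<and> p m = pr_ii m \<and> b m = bt s m \<and>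
       {k \<in> {1..N}. g m k} = {})"

definition untouched :: "nat \<Rightarrow> work \<Rightarrow> bool" where
  "untouched m w = (case w of (f, p, g, b) \<Rightarrow>
     fiber N f m = fiber N mu_ii m \<and> p m = pr_ii m \<and> b m = bt s m \<and>
     {k \<in> {1..N}. g m k} = S m)"

text \<open>The turn of \<open>m\<close> changes nothing that is recorded for other CUs, so the
  outcomes can be established one CU at a time. By the bound \<open>M\<close>, a nonzero value of
  the working matching is a CU, either already treated or still to come.\<close>

lemma fold_step_iii:
  assumes "j \<le> M"
  defines "w \<equiv> foldl (\<lambda>w m. step_iii eps N s m w)
                 (mu_ii, pr_ii, \<lambda>m k. P m k \<and> k \<notin> c ` R, bt s) [1..<j+1]"
  shows "(\<forall>m\<in>{1..j}. resolved m w) \<and> (\<forall>m\<in>{Suc j..M}. untouched m w) \<and>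
    (\<forall>k\<in>{1..N}. fst w k \<le> M)"
  using assms(1) unfolding w_def
proof (induction j)
  case 0
  have "mu_ii k \<le> M" if "k \<in> {1..N}" for k
    using that mu_le mu_ii_choice mu_ii_other[of k] by (cases "k \<in> c ` R") (auto simp: R_def)
  then show ?case by (auto simp: untouched_def S_def)
next
  case (Suc j)
  define m where "m = Suc j"
  have mM: "m \<in> {1..M}" using Suc.prems by (simp add: m_def)
  obtain f p g b where fold: "foldl (\<lambda>w m. step_iii eps N s m w)
      (mu_ii, pr_ii, \<lambda>m k. P m k \<and> k \<notin> c ` R, bt s) [1..<j+1] = (f, p, g, b)"
    by (rule prod_cases4)
  have res: "\<And>x. x \<in> {1..j} \<Longrightarrow> resolved x (f, p, g, b)"
    and unt: "\<And>x. x \<in> {m..M} \<Longrightarrow> untouched x (f, p, g, b)"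
    and fM: "\<And>k. k \<in> {1..N} \<Longrightarrow> f k \<le> M"
    using Suc.IH[OF Suc_leD[OF Suc.prems]] unfolding fold m_def by simp_all
  have upt: "[1..<Suc j + 1] = [1..<j+1] @ [m]" by (simp add: m_def)
  define w' where "w' = step_iii eps N s m (f, p, g, b)"
  have w': "foldl (\<lambda>w m. step_iii eps N s m w)
      (mu_ii, pr_ii, \<lambda>m k. P m k \<and> k \<notin> c ` R, bt s) [1..<Suc j+1] = w'"
    unfolding upt foldl_append fold w'_def by simp
  obtain f' p' g' b' where w'_eq: "w' = (f', p', g', b')" by (rule prod_cases4)
  have um: "fiber N f m = fiber N mu_ii m" "p m = pr_ii m" "b m = bt s m"
    "{k \<in> {1..N}. g m k} = S m"
    using unt[of m] mM by (auto simp: untouched_def)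
  define old where "old = partner N f m"
  have step: "w' = (if card (S m) = 1 \<and> (\<not> cu_matched N (mu s) m \<or> pr_ii m < bt s m) then
         ((f(old := 0))((THE n. n \<in> S m) := m), p(m := bt s m), g, b(m := bt s m))
       else if card (S m) \<ge> 1 then
         (f(old := 0), p(m := 0),
          (if old \<noteq> 0 \<and> pr_ii m = bt s m then g(m := (g m)(old := True)) else g),
          b(m := bt s m + eps))
       else (f, p, g, b))"
    unfolding w'_def step_iii_def old_def prod.case Let_def um(4) um(2) ..
  have finS: "finite (S m)" by (simp add: S_def)
  have cardS: "card (S m) \<ge> 1 \<longleftrightarrow> S m \<noteq> {}"
    using finS by (simp add: Suc_le_eq card_gt_0_iff)
  have prS: "pr_ii m = pr s m" "fiber N mu_ii m = fiber N (mu s) m" if "S m \<noteq> {}"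
    using that S_not_R fiber_ii[OF mM] by (auto simp: pr_ii_def)
  have old_fib: "(fiber N f m = {} \<and> old = 0) \<or> (fiber N f m = {old} \<and> old \<in> {1..N} \<and> f old = m)"
  proof -
    consider "fiber N f m = {}" | k where "fiber N f m = {k}"
      using fiber_ii_card[OF mM] um(1) by auto
    then show ?thesis
    proof cases
      case 2
      then show ?thesis using partner_singleton[OF 2] by (auto simp: old_def fiber_def)
    qed (simp add: old_def partner_empty)
  qed
  \<comment> \<open>A surviving proposer of \<open>m\<close> is unmatched after step (ii), and an
    earlier CU could have matched it only as its own proposer, which the single proposal per pair
    excludes.\<close>
  have free: "f k = 0" if k: "k \<in> S m" for k
  proof (rule ccontr)
    assume nz: "f k \<noteq> 0"
    have kN: "k \<in> {1..N}" using k by (simp add: S_def)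
    have fk: "k \<in> fiber N f (f k)" using kN by (simp add: fiber_def)
    have ni: "k \<notin> fiber N mu_ii (f k)" using S_unmatched[OF k] nz by (simp add: fiber_def)
    show False
    proof (cases "f k \<in> {1..j}")
      case True
      then have "k \<in> S (f k)" using res[OF True] fk ni by (auto simp: resolved_def split: if_splits)
      then have "f k = m" using k proposal_unique S_proposal by blast
      then show False using True by (simp add: m_def)
    next
      case False
      then have "f k \<in> {m..M}" using fM[OF kN] nz by (auto simp: m_def)
      then show False using unt fk ni by (auto simp: untouched_def)
    qed
  qed
  have S1: "\<exists>n. S m = {n} \<and> (THE n. n \<in> S m) = n \<and> n \<in> {1..N} \<and> f n = 0" if c1: "card (S m) = 1"
  proof -
    obtain n where "S m = {n}" using c1 by (auto simp: card_1_singleton_iff)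
    moreover from this have "n \<in> {1..N}" by (auto simp: S_def)
    ultimately show ?thesis using free by auto
  qed
  have others: "fiber N f' x = fiber N f x \<and> p' x = p x \<and> g' x = g x \<and> b' x = b x"
    if x: "x \<noteq> m" "x \<noteq> 0" for x
  proof -
    \<comment> \<open>Without a partner \<open>old\<close> is 0, and an update at index 0 is
      invisible to fibres, which lie in \<open>{1..N}\<close>.\<close>
    have o: "fiber N (f(old := 0)) x = fiber N f x"
      using old_fib x by (auto simp: fiber_def)
    let ?acc = "card (S m) = 1 \<and> (\<not> cu_matched N (mu s) m \<or> pr_ii m < bt s m)"
    consider ?acc | "\<not> ?acc" "card (S m) \<ge> 1" | "\<not> ?acc" "\<not> card (S m) \<ge> 1" by blast
    then show ?thesis
    proof cases
      case 1
      then obtain n where n: "(THE n. n \<in> S m) = n" "n \<in> {1..N}" "f n = 0" using S1 by blast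
      have "fiber N (f(old := 0, n := m)) x = fiber N (f(old := 0)) x"
        using n x by (auto simp: fiber_def)
      then show ?thesis using step[unfolded if_P[OF 1] n(1) w'_eq] o x(1) by simp
    next
      case 2
      show ?thesis using step[unfolded if_not_P[OF 2(1)] if_P[OF 2(2)] w'_eq] o x(1) by simp
    next
      case 3
      show ?thesis using step[unfolded if_not_P[OF 3(1)] if_not_P[OF 3(2)] w'_eq] by simp
    qed
  qed
  have here: "resolved m w'"
  proof -
    consider (acc) "accepts m" | (over) "\<not> accepts m" "S m \<noteq> {}" | (idle) "S m = {}"
      by blast
    then show ?thesis
    proof cases
      case acc
      then have "S m \<noteq> {}" by (auto simp: accepts_def)
      with acc have e: "w' = ((f(old := 0))((THE n. n \<in> S m) := m), p(m := bt s m), g, b(m := bt s m))"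
        unfolding step using prS by (auto simp: accepts_def)
      from acc S1 obtain n where n: "S m = {n}" "(THE n. n \<in> S m) = n" "n \<in> {1..N}" "f n = 0"
        by (auto simp: accepts_def)
      have "fiber N ((f(old := 0))(n := m)) m = {n}"
        using n old_fib mM by (auto simp: fiber_def)
      then show ?thesis using acc n by (simp add: e resolved_def)
    next
      case over
      then have e: "w' = (f(old := 0), p(m := 0),
          (if old \<noteq> 0 \<and> pr s m = bt s m then g(m := (g m)(old := True)) else g),
          b(m := bt s m + eps))"
        unfolding step using prS cardS by (auto simp: accepts_def)
      have fo: "fiber N (f(old := 0)) m = {}" using old_fib mM by (auto simp: fiber_def)
      have "{k \<in> {1..N}. (if old \<noteq> 0 \<and> pr s m = bt s m then g(m := (g m)(old := True)) else g) m k}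
          = S m \<union> {k \<in> fiber N (mu s) m. pr s m = bt s m}"
        using old_fib um(1) prS(2)[OF over(2)] um(4)[symmetric] by (auto split: if_splits)
      then show ?thesis using over fo by (simp add: e resolved_def)
    next
      case idle
      then have "w' = (f, p, g, b)" "\<not> accepts m" unfolding step by (auto simp: accepts_def)
      then show ?thesis using um idle by (simp add: resolved_def)
    qed
  qed
  have "resolved x w'" if "x \<in> {1..Suc j}" for x
  proof (cases "x = m")
    case False
    then have "x \<in> {1..j}" using that by (auto simp: m_def)
    moreover from this have "fiber N f' x = fiber N f x" "p' x = p x" "g' x = g x" "b' x = b x"
      using others[of x] False by auto
    ultimately show ?thesis using res unfolding w'_eq resolved_def prod.case by (simp only:)
  qed (use here in simp)
  moreover have "untouched x w'" if "x \<in> {Suc (Suc j)..M}" for x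
  proof -
    have "fiber N f' x = fiber N f x" "p' x = p x" "g' x = g x" "b' x = b x" "x \<in> {m..M}"
      using others[of x] that by (auto simp: m_def)
    then show ?thesis using unt unfolding w'_eq untouched_def prod.case by (simp only:)
  qed
  moreover have "f' k \<le> M" if "k \<in> {1..N}" for k
    using step fM[OF that] mM unfolding w'_eq by (auto split: if_splits)
  ultimately show ?case unfolding w' by (auto simp: w'_eq)
qed

lemma iterate_spec:
  "btp s' = bt s"
  "m \<in> {1..M} \<Longrightarrow> resolved m (mu s', pr s', gp s', bt s')"
  "k \<in> {1..N} \<Longrightarrow> mu s' k \<le> M"
proof -
  obtain f p g b where w: "foldl (\<lambda>w m. step_iii eps N s m w)
      (mu_ii, pr_ii, \<lambda>m k. P m k \<and> k \<notin> c ` R, bt s) [1..<M+1] = (f, p, g, b)"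
    by (rule prod_cases4)
  have s': "s' = \<lparr>mu = f, pr = p, bt = b, btp = bt s, gp = g\<rparr>"
    unfolding iterate_def fold_step_ii_all w Let_def by simp
  show "btp s' = bt s" by (simp add: s')
  show "m \<in> {1..M} \<Longrightarrow> resolved m (mu s', pr s', gp s', bt s')"
    "k \<in> {1..N} \<Longrightarrow> mu s' k \<le> M"
    using fold_step_iii[OF order_refl] unfolding w by (simp_all add: s')
qed

section \<open>Preservation of the invariant by one iteration\<close>

lemma matched_after:
  assumes "k \<in> {1..N}" "mu s' k = m" "m \<noteq> 0"
  shows "m \<in> {1..M}" "bt s' m = bt s m"
    "k \<in> S m \<and> pr s' m = bt s m \<or> S m = {} \<and> mu_ii k = m \<and> pr s' m = pr_ii m"
proof -
  show m: "m \<in> {1..M}" using assms iterate_spec(3)[of k] by auto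
  have "k \<in> fiber N (mu s') m" using assms by (simp add: fiber_def)
  then show "bt s' m = bt s m"
    "k \<in> S m \<and> pr s' m = bt s m \<or> S m = {} \<and> mu_ii k = m \<and> pr s' m = pr_ii m"
    using iterate_spec(2)[OF m] by (auto simp: resolved_def fiber_def split: if_splits)
qed

lemma accepts_nonempty: "accepts m \<Longrightarrow> S m \<noteq> {}"
  by (auto simp: accepts_def)

text \<open>Acceptance leaves a CU matched, and without surviving proposals its row of
  \<open>gp\<close> is empty; so a CU pending after the iteration has just been raised.\<close>

lemma pending_after:
  assumes m: "m \<in> {1..M}" and pend: "pending N s' m"
  shows "\<not> accepts m" "S m \<noteq> {}" "bt s' m = bt s m + eps"
    "{k \<in> {1..N}. gp s' m k} = S m \<union> {k \<in> fiber N (mu s) m. pr s m = bt s m}"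
proof -
  have "fiber N (mu s') m = {}" "{k \<in> {1..N}. gp s' m k} \<noteq> {}"
    using pend by (auto simp: pending_def cu_matched_iff_fiber)
  then have "\<not> accepts m \<and> S m \<noteq> {} \<and> bt s' m = bt s m + eps \<and>
      {k \<in> {1..N}. gp s' m k} = S m \<union> {k \<in> fiber N (mu s) m. pr s m = bt s m}"
    using iterate_spec(2)[OF m] accepts_nonempty[of m] unfolding resolved_def prod.case
    by (metis (no_types, lifting))
  then show "\<not> accepts m" "S m \<noteq> {}" "bt s' m = bt s m + eps"
    "{k \<in> {1..N}. gp s' m k} = S m \<union> {k \<in> fiber N (mu s) m. pr s m = bt s m}"
    by blast+
qed

lemma overdemanded_after:
  assumes m: "m \<in> {1..M}" and "\<not> accepts m" "S m \<noteq> {}"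
  shows "pending N s' m"
proof -
  have "fiber N (mu s') m = {}" "S m \<subseteq> {k \<in> {1..N}. gp s' m k}"
    using iterate_spec(2)[OF m] assms by (simp_all add: resolved_def)
  then show ?thesis using assms(3) by (auto simp: pending_def cu_matched_iff_fiber)
qed

lemma bt_after:
  assumes m: "m \<in> {1..M}"
  shows "bt s m \<le> bt s' m" "bt s' m \<noteq> bt s m \<Longrightarrow> pending N s' m"
  using iterate_spec(2)[OF m] overdemanded_after[OF m] eps_pos
  by (auto simp: resolved_def split: if_splits)

text \<open>A surviving proposer proposed to no other CU and was not taken back in step (ii). A
  former partner was matched, hence neither proposed nor was taken back. So neither can have moved
  to another CU, and \<open>m\<close> itself is unmatched.\<close>

lemma group_unmatched:
  assumes m: "m \<in> {1..M}" "pending N s' m" and k: "k \<in> {1..N}" "gp s' m k"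
  shows "mu s' k = 0"
proof (rule ccontr)
  assume nz: "mu s' k \<noteq> 0"
  note a = matched_after[OF k(1) refl nz]
  have ne: "mu s' k \<noteq> m" using m(2) k(1) by (auto simp: pending_def cu_matched_def)
  have "k \<in> S m \<or> k \<in> fiber N (mu s) m" using pending_after(4)[OF m] k by blast
  then show False
  proof
    assume kS: "k \<in> S m"
    then have "k \<notin> S (mu s' k)" using ne proposal_unique S_proposal by blast
    then show False using a(3) S_unmatched[OF kS] nz by simp
  next
    assume kf: "k \<in> fiber N (mu s) m"
    then have "mu s k \<noteq> 0" using m(1) by (simp add: fiber_def)
    then have "k \<notin> S (mu s' k)"
      using S_proposal[of k "mu s' k"] proposal_demand(2)[of "mu s' k" k] by auto
    then have "mu_ii k = mu s' k" using a(3) by blast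
    moreover have "k \<notin> c ` R" using R_choice(3) \<open>mu s k \<noteq> 0\<close> by auto
    ultimately show False using mu_ii_other[of k] kf ne by (simp add: fiber_def)
  qed
qed

lemma dma_inv_after: "dma_inv v eps M N s'"
proof
  show "0 < eps" by (rule eps_pos)
  show "k \<in> {1..N} \<Longrightarrow> mu s' k \<le> M" for k by (rule iterate_spec(3))
  show "0 \<le> bt s' m" if "m \<in> {1..M}" for m
    using bt_nonneg[OF that] bt_after(1)[OF that] by simp
  show "btp s' m \<le> bt s' m" if "m \<in> {1..M}" for m
    using bt_after(1)[OF that] iterate_spec(1) by simp
  show "k = l" if kl: "k \<in> {1..N}" "l \<in> {1..N}" "mu s' k = mu s' l" "mu s' k \<noteq> 0" for k l
  proof -
    define m where "m = mu s' k"
    have m: "m \<in> {1..M}" using matched_after(1)[OF kl(1) refl kl(4)] by (simp add: m_def)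
    have f: "k \<in> fiber N (mu s') m" "l \<in> fiber N (mu s') m" using kl by (auto simp: m_def fiber_def)
    have "fiber N (mu s') m = {} \<or> (\<exists>x. fiber N (mu s') m = {x})"
      using iterate_spec(2)[OF m] fiber_ii_card[OF m]
      by (auto simp: resolved_def accepts_def card_1_singleton_iff split: if_splits)
    with f show ?thesis by auto
  qed
  show "bt s' m - eps \<le> pr s' m \<and> pr s' m \<le> bt s' m"
    if km: "k \<in> {1..N}" "mu s' k = m" "m \<noteq> 0" for k m
  proof (cases "k \<in> S m \<and> pr s' m = bt s m")
    case True
    then show ?thesis using matched_after(2)[OF km] eps_pos by simp
  next
    case False
    then have a: "mu_ii k = m" "pr s' m = pr_ii m" using matched_after(3)[OF km] by auto
    show ?thesis
    proof (cases "m \<in> R")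
      case True
      then have "bt s m = btp s m + eps" using pending_price by (simp add: R_def)
      then show ?thesis using True a matched_after(2)[OF km] eps_pos by (simp add: pr_ii_def)
    next
      case mR: False
      then have "mu s k = m"
        using fiber_ii[OF matched_after(1)[OF km]] a(1) km(1) by (auto simp: fiber_def)
      then show ?thesis
        using matched_price[OF km(1) _ km(3)] a mR matched_after(2)[OF km] by (simp add: pr_ii_def)
    qed
  qed
  show "best_at v M (bt s') k m (pr s' m)"
    if km: "k \<in> {1..N}" "mu s' k = m" "m \<noteq> 0" for k m
  proof (cases "k \<in> S m \<and> pr s' m = bt s m")
    case True
    then have "best_at v M (bt s) k m (pr s' m)" using proposal_demand(4) S_proposal by simp
    then show ?thesis by (rule best_at_mono) (use bt_after in auto)
  next
    case False
    then have a: "mu_ii k = m" "pr s' m = pr_ii m" using matched_after(3)[OF km] by auto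
    have k: "k \<in> fiber N mu_ii m" using a km by (simp add: fiber_def)
    show ?thesis
    proof (cases "m \<in> R")
      case True
      then have "k = c m" using k fiber_ii[OF matched_after(1)[OF km]] by simp
      then have "best_at v M (btp s) k m (pr s' m)"
        using R_choice(4)[OF True] a True by (simp add: pr_ii_def)
      then show ?thesis by (rule best_at_mono) (use bt_after btp_le in \<open>auto intro: order_trans\<close>)
    next
      case mR: False
      then have "mu s k = m" using fiber_ii[OF matched_after(1)[OF km]] k by (simp add: fiber_def)
      then have "best_at v M (bt s) k m (pr s' m)"
        using matched_best[OF km(1) _ km(3)] a mR by (simp add: pr_ii_def)
      then show ?thesis by (rule best_at_mono) (use bt_after in auto)
    qed
  qed
  show "bt s' m = btp s' m + eps" if "m \<in> {1..M}" "pending N s' m" for m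
    using pending_after(3)[OF that] iterate_spec(1) by simp
  show "mu s' k = 0 \<and> best_at v M (btp s') k m (btp s' m)"
    if m: "m \<in> {1..M}" "pending N s' m" and k: "k \<in> {1..N}" "gp s' m k" for m k
  proof -
    have "k \<in> S m \<or> k \<in> fiber N (mu s) m \<and> pr s m = bt s m"
      using pending_after(4)[OF m] k by blast
    then have "best_at v M (bt s) k m (bt s m)"
    proof
      assume "k \<in> S m"
      then show ?thesis using proposal_demand(4) S_proposal by blast
    next
      assume "k \<in> fiber N (mu s) m \<and> pr s m = bt s m"
      then show ?thesis using matched_best[OF k(1), of m] m(1) by (simp add: fiber_def)
    qed
    then show ?thesis using group_unmatched[OF m k] iterate_spec(1) by simp
  qed
  show "2 \<le> card {k \<in> {1..N}. gp s' m k}" if m: "m \<in> {1..M}" "pending N s' m" for m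
  proof -
    note p = pending_after[OF m]
    have finS: "finite (S m)" by (simp add: S_def)
    show ?thesis
    \<comment> \<open>A single proposal is refused only if \<open>m\<close> has a partner that pays
      the full \<beta>. That partner then joins the group and, being matched, is not the
      proposer.\<close>
    proof (cases "card (S m) = 1")
      case False
      moreover have "card (S m) \<noteq> 0" using p(2) finS by simp
      ultimately have "2 \<le> card (S m)" by linarith
      also have "\<dots> \<le> card {k \<in> {1..N}. gp s' m k}" by (rule card_mono) (simp, use p(4) in blast)
      finally show ?thesis .
    next
      case True
      with p(1) have cu: "cu_matched N (mu s) m" "\<not> pr s m < bt s m" by (auto simp: accepts_def)
      then obtain l where l: "l \<in> {1..N}" "mu s l = m" by (auto simp: cu_matched_def)
      with cu(2) have "pr s m = bt s m" using matched_price[OF l] m(1) by simp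
      with l have sub: "insert l (S m) \<subseteq> {k \<in> {1..N}. gp s' m k}"
        unfolding p(4) by (auto simp: fiber_def)
      have "l \<notin> S m" using l m(1) S_proposal[of l m] proposal_demand(2)[of m l] by auto
      then have "2 = card (insert l (S m))" using True finS by simp
      also have "\<dots> \<le> card {k \<in> {1..N}. gp s' m k}" by (rule card_mono) (use sub in auto)
      finally show ?thesis .
    qed
  qed
  show "m = x" if m: "m \<in> {1..M}" "pending N s' m" and x: "x \<in> {1..M}" "pending N s' x"
    and k: "k \<in> {1..N}" "gp s' m k" "gp s' x k" for m x k
  proof -
    have km: "k \<in> S m \<or> k \<in> fiber N (mu s) m" using pending_after(4)[OF m] k by blast
    have kx: "k \<in> S x \<or> k \<in> fiber N (mu s) x" using pending_after(4)[OF x] k by blast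
    \<comment> \<open>A pair enters a group either as a proposer, which requires being unmatched, or
      as a former partner; each role determines the CU.\<close>
    show ?thesis
    proof (cases "mu s k = 0")
      case True
      then have "k \<in> S m" "k \<in> S x" using km kx m(1) x(1) by (auto simp: fiber_def)
      then show ?thesis using proposal_unique S_proposal by blast
    next
      case False
      then have "k \<notin> S y" for y using S_proposal[of k y] proposal_demand(2)[of y k] by auto
      then show ?thesis using km kx by (simp add: fiber_def)
    qed
  qed
  show "cu_matched N (mu s') m \<or> pending N s' m" if m: "m \<in> {1..M}" and pos: "0 < bt s' m" for m
  proof -
    consider "accepts m" | "\<not> accepts m" "S m \<noteq> {}" | "\<not> accepts m" "S m = {}" by blast
    then show ?thesis
    proof cases
      case 1
      then have "fiber N (mu s') m = S m" using iterate_spec(2)[OF m] by (simp add: resolved_def)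
      then show ?thesis using accepts_nonempty[OF 1] by (simp add: cu_matched_iff_fiber)
    next
      case 2
      then show ?thesis using overdemanded_after[OF m] by blast
    next
      case 3
      then have f: "fiber N (mu s') m = fiber N mu_ii m" "bt s' m = bt s m"
        using iterate_spec(2)[OF m] by (simp_all add: resolved_def)
      have "fiber N mu_ii m \<noteq> {}"
      proof (cases "m \<in> R")
        case True
        then show ?thesis using fiber_ii[OF m] by simp
      next
        case False
        \<comment> \<open>Were \<open>m\<close> pending but outside \<open>R\<close>, one of its
          proposals would survive step (ii), against \<open>S m = {}\<close>.\<close>
        have "\<not> pending N s m"
        proof
          assume pend: "pending N s m"
          then obtain k where k: "P m k" using False m by (auto simp: R_def)
          then have "k \<in> c ` R" using 3(2) proposal_demand(1)[OF k] by (auto simp: S_def)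
          then show False using pending_not_abandoned[OF m pend] k by blast
        qed
        then have "cu_matched N (mu s) m" using priced[OF m] pos f(2) by simp
        then show ?thesis using fiber_ii[OF m] False by (simp add: cu_matched_iff_fiber)
      qed
      then show ?thesis using f(1) by (simp add: cu_matched_iff_fiber)
    qed
  qed
qed

end

section \<open>Overdemand and the comparison of two runs\<close>

text \<open>The Hall-type condition. It is kept apart from \<open>dma_inv\<close> because it goes
  back to the last raise inside \<open>T\<close>, which may be many iterations old.\<close>

definition overdemanded :: "(nat \<Rightarrow> nat \<Rightarrow> real) \<Rightarrow> real \<Rightarrow> nat \<Rightarrow> nat \<Rightarrow> dma_state \<Rightarrow> bool" where
  "overdemanded v eps M N s \<longleftrightarrow>
     (\<forall>T. T \<subseteq> {1..M} \<and> T \<noteq> {} \<and> (\<forall>m\<in>T. 0 < bt s m) \<longrightarrow>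
        card T < card (tight v eps M N (bt s) T))"

lemma dma_step_iteration:
  assumes "dma_inv v eps M N s" "dma_step v eps M N s s'"
  obtains c where "dma_iteration v eps M N s c" "s' = iterate v eps M N c s"
proof -
  interpret dma_inv v eps M N s by fact
  from assms(2) obtain c where c: "no_ties v M N (bt s)" "s' = iterate v eps M N c s"
    "\<forall>m\<in>{1..M}. (\<exists>n\<in>{1..N}. gp s m n) \<longrightarrow> c m \<in> {1..N} \<and> gp s m (c m)"
    by (auto simp: dma_step_def)
  have "dma_iteration v eps M N s c" by unfold_locales (use c in auto)
  with c(2) that show thesis by blast
qed

text \<open>If a price in \<open>T\<close> has just been raised, that CU is pending and
  \<open>overdemand_of_pending\<close> counts afresh. Otherwise the prices in \<open>T\<close> are
  unchanged and the others can only have grown, so every tight pair stays tight.\<close>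

lemma dma_step_preserves:
  assumes "dma_inv v eps M N s" "overdemanded v eps M N s" "dma_step v eps M N s s'"
  shows "dma_inv v eps M N s' \<and> overdemanded v eps M N s'"
proof -
  obtain c where it: "dma_iteration v eps M N s c" and s': "s' = iterate v eps M N c s"
    using dma_step_iteration[OF assms(1,3)] .
  interpret dma_iteration v eps M N s c by fact
  have inv: "dma_inv v eps M N s'" unfolding s' by (rule dma_inv_after)
  interpret new: dma_inv v eps M N s' by fact
  have "card T < card (tight v eps M N (bt s') T)"
    if T: "T \<subseteq> {1..M}" "T \<noteq> {}" "\<forall>m\<in>T. 0 < bt s' m" for T
  proof (cases "\<exists>m\<in>T. bt s' m \<noteq> bt s m")
    case True
    then obtain y where "y \<in> T" "pending N s' y" using bt_after(2) T(1) s' by blast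
    then show ?thesis using new.overdemand_of_pending[OF T(1)] T(3) by blast
  next
    case False
    then have "card T < card (tight v eps M N (bt s) T)"
      using assms(2) T by (simp add: overdemanded_def)
    also have "\<dots> \<le> card (tight v eps M N (bt s') T)"
    proof (rule card_mono)
      show "tight v eps M N (bt s) T \<subseteq> tight v eps M N (bt s') T"
        using False bt_after(1) unfolding tight_def s' by (fastforce intro: best_at_mono)
    qed (simp add: tight_def)
    finally show ?thesis .
  qed
  then show ?thesis using inv by (simp add: overdemanded_def)
qed

lemma dma_inv_init: "0 < eps \<Longrightarrow> dma_inv v eps M N dma_init \<and> overdemanded v eps M N dma_init"
  by (auto simp: dma_inv_def overdemanded_def dma_init_def pending_def)

lemma dma_reach_preserves:
  assumes "0 < eps" "dma_reach v eps M N s"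
  shows "dma_inv v eps M N s \<and> overdemanded v eps M N s"
  using assms(2)
proof induction
  case init
  show ?case by (rule dma_inv_init[OF assms(1)])
next
  case (step s s')
  then show ?case using dma_step_preserves[of v eps M N s s'] by blast
qed

text \<open>The third property uses the stopping rule: the last iteration has no proposal, so it
  changes no \<beta> and releases no pair. A pair unmatched at the end therefore demanded nothing at
  the final \<beta>.\<close>

lemma dma_output_properties:
  assumes "0 < eps" "dma_output v eps M N s'"
  shows "dma_inv v eps M N s'" "overdemanded v eps M N s'"
    "\<And>k x. \<lbrakk>k \<in> {1..N}; mu s' k = 0; x \<in> {1..M}\<rbrakk> \<Longrightarrow> v x k < bt s' x"
proof -
  from assms(2) obtain s where s: "dma_reach v eps M N s" "\<not> has_proposal v M N s"
    "dma_step v eps M N s s'" by (auto simp: dma_output_def)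
  note inv = dma_reach_preserves[OF assms(1) s(1)]
  from dma_step_preserves[OF conjunct1[OF inv] conjunct2[OF inv] s(3)]
  show "dma_inv v eps M N s'" "overdemanded v eps M N s'" by auto
  obtain c where it: "dma_iteration v eps M N s c" and s': "s' = iterate v eps M N c s"
    using dma_step_iteration[OF conjunct1[OF inv] s(3)] .
  interpret dma_iteration v eps M N s c by fact
  fix k x assume k: "k \<in> {1..N}" "mu s' k = 0" and x: "x \<in> {1..M}"
  have noP: "\<not> P m l" for m l
  proof
    assume "P m l"
    then show False using s(2) proposal_demand(1,3)[of m l] by (auto simp: has_proposal_def)
  qed
  have same: "fiber N (mu s') m = fiber N mu_ii m" "bt s' m = bt s m" if "m \<in> {1..M}" for m
    using iterate_spec(2)[OF that] noP unfolding s' by (auto simp: resolved_def accepts_def S_def)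
  have "mu s k = 0"
  proof (rule ccontr)
    assume nz: "mu s k \<noteq> 0"
    then have m: "mu s k \<in> {1..M}" using mu_le[OF k(1)] by simp
    have "k \<notin> c ` R" using nz R_choice(3) by auto
    then have "k \<in> fiber N mu_ii (mu s k)" using k(1) mu_ii_other by (simp add: fiber_def)
    then have "k \<in> fiber N (mu s') (mu s k)" using same(1)[OF m] by blast
    then show False using k(2) nz by (simp add: fiber_def)
  qed
  then have "demand v M (bt s) k = 0" using noP[of _ k] k(1) by (auto simp: proposals_def)
  then show "v x k < bt s' x" using demand_zero[OF unique_demand k(1) _ x] same(2)[OF x] by simp
qed

section \<open>Comparison of the truthful and the deviating run\<close>

theorem theorem4:
  fixes M N n :: nat and v :: "nat \<Rightarrow> nat \<Rightarrow> real" and w :: "nat \<Rightarrow> real"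
    and eps :: real and \<Phi> \<Phi>' :: dma_state
  assumes "eps > 0"
    and "n \<in> {1..N}"
    and "dma_output v eps M N \<Phi>"
    and "dma_output (deviate v n w) eps M N \<Phi>'"
  shows "utility v N \<Phi>' n \<le> utility v N \<Phi> n + (8 * real (min M N) + 1) * eps"
proof (rule ccontr)
  define L where "L = min M N"
  assume "\<not> ?thesis"
  then have gain: "utility v N \<Phi> n + (8 * real L + 1) * eps < utility v N \<Phi>' n"
    by (simp add: L_def)
  note out = dma_output_properties[OF assms(1,3)]
  note out' = dma_output_properties[OF assms(1,4)]
  interpret A: dma_inv v eps M N \<Phi> by (rule out(1))
  interpret B: dma_inv "deviate v n w" eps M N \<Phi>' by (rule out'(1))
  have util: "utility v N s k = v (mu s k) k - pr s (mu s k)" if "k \<in> {1..N}" "mu s k \<noteq> 0" for s k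
    using that by (auto simp: utility_def out_price_def cu_matched_def)
  have truthful: "v x n - bt \<Phi> x \<le> utility v N \<Phi> n" if "x \<in> {1..M}" for x
  proof (cases "mu \<Phi> n = 0")
    case True
    then show ?thesis using out(3)[OF assms(2) True that] by (simp add: utility_def)
  next
    case False
    then show ?thesis using A.matched_best[OF assms(2) refl False] util[OF assms(2) False] that
      by (simp add: best_at_def)
  qed
  \<comment> \<open>A truthful pair never ends below 0, so the assumed gain makes its utility after
    deviating positive, which forces \<open>n\<close> to be matched there.\<close>
  have "0 \<le> utility v N \<Phi> n"
  proof (cases "mu \<Phi> n = 0")
    case False
    then show ?thesis using A.matched_best[OF assms(2) refl False] util[OF assms(2) False]
      by (simp add: best_at_def)
  qed (simp add: utility_def)
  moreover have "0 < (8 * real L + 1) * eps" using assms(1) by simp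
  ultimately have "0 < utility v N \<Phi>' n" using gain by linarith
  then have nz: "mu \<Phi>' n \<noteq> 0" by (auto simp: utility_def split: if_splits)
  define m0 where "m0 = mu \<Phi>' n"
  have m0: "m0 \<in> {1..M}" using nz B.mu_le[OF assms(2)] by (simp add: m0_def)
  \<comment> \<open>The thresholds advance by \<open>2 * eps\<close>: one \<open>eps\<close> is the
    slack of \<open>tight\<close>, the other is lost because a price may lie \<open>eps\<close>
    below \<beta>.\<close>
  define T where "T j = {m \<in> {1..M}. bt \<Phi>' m + real (2 * j) * eps < bt \<Phi> m}" for j :: nat
  \<comment> \<open>One \<epsilon> of the claimed bound pays for the gap between price and \<beta>
    in the deviating run; the remaining \<open>8 * L\<close> is twice the top level
    \<open>4 * L\<close>.\<close>
  have m0T: "m0 \<in> T j" if "j \<le> 4 * L" for j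
  proof -
    have "bt \<Phi>' m0 - eps \<le> pr \<Phi>' m0" using B.matched_price[OF assms(2) refl nz] by (simp add: m0_def)
    then have "bt \<Phi>' m0 + 8 * real L * eps < bt \<Phi> m0"
      using gain truthful[OF m0] util[OF assms(2) nz] by (simp add: m0_def algebra_simps)
    moreover have "real (2 * j) * eps \<le> 8 * real L * eps"
      using that assms(1) by (intro mult_right_mono) auto
    ultimately have "bt \<Phi>' m0 + real (2 * j) * eps < bt \<Phi> m0" by linarith
    then show ?thesis using m0 by (simp add: T_def)
  qed
  have pos: "0 < bt \<Phi> m" if "m \<in> T j" for m j
  proof -
    have "0 \<le> bt \<Phi>' m" using B.bt_nonneg that by (simp add: T_def)
    moreover have "0 \<le> real (2 * j) * eps" using assms(1) by simp
    moreover have "bt \<Phi>' m + real (2 * j) * eps < bt \<Phi> m" using that by (simp add: T_def)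
    ultimately show ?thesis by linarith
  qed
  have over: "card (T j) < card (tight v eps M N (bt \<Phi>) (T j))" if "j \<le> 4 * L" for j
  proof -
    have "T j \<subseteq> {1..M}" "T j \<noteq> {}" using m0T[OF that] by (auto simp: T_def)
    then show ?thesis using out(2) pos[of _ j] unfolding overdemanded_def by blast
  qed
  have grow: "card (T (Suc j)) < card (T j)" if j: "Suc j \<le> 4 * L" for j
  proof -
    let ?K = "tight v eps M N (bt \<Phi>) (T (Suc j))"
    have dest: "mu \<Phi>' k \<noteq> 0 \<and> mu \<Phi>' k \<in> T j" if k: "k \<in> ?K" for k
    proof (cases "k = n")
      \<comment> \<open>The deviating run says nothing about the true preferences of
        \<open>n\<close>, but its CU there, \<open>m0\<close>, lies in every level
        considered.\<close>
      case True
      then show ?thesis using m0T[of j] j nz by (simp add: m0_def)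
    next
      case False
      have kN: "k \<in> {1..N}" using k by (simp add: tight_def)
      have dev: "deviate v n w m k = v m k" for m using False by (simp add: deviate_def)
      obtain m where m: "m \<in> T (Suc j)" "best_at v M (bt \<Phi>) k m (bt \<Phi> m - eps)"
        using k by (auto simp: tight_def)
      have mM: "m \<in> {1..M}" using m(1) by (simp add: T_def)
      have gap: "bt \<Phi>' m + real (2 * j) * eps + 2 * eps < bt \<Phi> m"
        using m(1) by (simp add: T_def algebra_simps)
      have j0: "0 \<le> real (2 * j) * eps" using assms(1) by simp
      have "bt \<Phi> m - eps \<le> v m k" using m(2) by (simp add: best_at_def)
      \<comment> \<open>At the lower \<beta> of the deviating run \<open>m\<close> is still
        acceptable to \<open>k\<close>, so \<open>k\<close> cannot end unmatched there.\<close>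
      then have "\<not> v m k < bt \<Phi>' m" using gap j0 assms(1) by linarith
      then have knz: "mu \<Phi>' k \<noteq> 0" using out'(3)[OF kN _ mM] dev by auto
      define x where "x = mu \<Phi>' k"
      have xM: "x \<in> {1..M}" using knz B.mu_le[OF kN] by (simp add: x_def)
      \<comment> \<open>Adding the next three inequalities cancels the values of \<open>k\<close>
        and loses two \<epsilon>, which leaves the excess of \<beta> at \<open>x\<close> above the
        threshold of level \<open>j\<close>.\<close>
      have "v m k - bt \<Phi>' m \<le> v x k - pr \<Phi>' x"
        using B.matched_best[OF kN refl knz] mM by (simp add: best_at_def dev x_def)
      moreover have "v x k - bt \<Phi> x \<le> v m k - (bt \<Phi> m - eps)"
        using m(2) xM by (simp add: best_at_def)
      moreover have "bt \<Phi>' x - eps \<le> pr \<Phi>' x"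
        using B.matched_price[OF kN refl knz] by (simp add: x_def)
      ultimately have "bt \<Phi>' x + real (2 * j) * eps < bt \<Phi> x" using gap by linarith
      then show ?thesis using knz xM by (simp add: T_def x_def)
    qed
    have "inj_on (mu \<Phi>') ?K"
    proof (rule inj_onI)
      fix k l assume kl: "k \<in> ?K" "l \<in> ?K" "mu \<Phi>' k = mu \<Phi>' l"
      then have "k \<in> {1..N}" "l \<in> {1..N}" by (simp_all add: tight_def)
      then show "k = l" using B.mu_inj[of k l] kl(3) dest[OF kl(1)] by blast
    qed
    then have "card ?K \<le> card (T j)"
    proof (rule card_inj_on_le)
      show "mu \<Phi>' ` ?K \<subseteq> T j" using dest by blast
    qed (simp add: T_def)
    then show ?thesis using over[OF j] by linarith
  qed
  \<comment> \<open>Each step down from the nonempty top level \<open>T (4 * L)\<close> adds at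
    least one member.\<close>
  have "j < card (T (4 * L - j))" if "j \<le> 4 * L" for j
    using that
  proof (induction j)
    case 0
    have "finite (T (4 * L))" by (simp add: T_def)
    then show ?case using m0T[of "4 * L"] by (auto simp: card_gt_0_iff)
  next
    case (Suc j)
    have "Suc (4 * L - Suc j) = 4 * L - j" using Suc.prems by simp
    then show ?case using Suc grow[of "4 * L - Suc j"] by simp
  qed
  then have "4 * L < card (T 0)" by fastforce
  \<comment> \<open>\<open>T 0\<close> has at most \<open>M\<close> members and, being outnumbered
    by its tight pairs, fewer than \<open>N\<close>; hence at most \<open>L\<close>.\<close>
  moreover have "card (T 0) \<le> card {1..M}" by (rule card_mono) (auto simp: T_def)
  moreover have "card (tight v eps M N (bt \<Phi>) (T 0)) \<le> card {1..N}"
    by (rule card_mono) (auto simp: tight_def)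
  ultimately show False using over[of 0] by (simp add: L_def min_def split: if_splits)
qed

end
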